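(* Let $(a_n)_{n\ge 0}$, $(b_n)_{n\ge 0}$ be sequences of complex numbers with $b_0=1$ and $a_n\ne 0$ for all $n\ge 0$. Let $\mathscr{A}$ be the infinite lower triangular matrix with entries $\mathscr{A}_{n,k}=a_nb_{n-k}a_k^{-1}$ for $n\ge k\ge 0$ (and $0$ for $k>n$). Then for every integer $j$ (positive, zero or negative), the matrix power $\mathscr{A}^j$ belongs to $SDR_\infty$ (where $\mathscr{A}^0$ is the identity matrix).
   Context: All matrices are infinite lower triangular matrices $\mathscr{A}=(A_{n,k})_{n\ge k\ge 0}$ with complex entries; we set $A_{n,k}=0$ whenever $k>n$. For an integer $m\ge 3$, $\mathscr{A}$ is called an SDR-matrix of order $m$ (written $\mathscr{A}\in SDR_m$) if for all integers $n,k\ge 0$, all $2\le p\le m-1$ and all $0\le r\le p-1$, $$\prod_{i=0}^{r}A_{n+i,k+r-i}\prod_{i=0}^{p-r-1}A_{n+p-i,k+r+i+1}=\prod_{i=0}^{r}A_{n+p-i,k+p-r+i}\prod_{i=0}^{p-r-1}A_{n+i,k+p-r-i-1}.$$ $SDR_\infty$ denotes the set of matrices lying in $SDR_m$ for every $m\ge 3$. *)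

theory Defs
  imports Complex_Main
begin

type_synonym inf_matrix = "nat \<Rightarrow> nat \<Rightarrow> complex"

definition lower_triangular :: "inf_matrix \<Rightarrow> bool" where
  "lower_triangular A \<longleftrightarrow> (\<forall>n k. n < k \<longrightarrow> A n k = 0)"

text \<open>For a lower triangular left factor the terms with \<open>i > n\<close> vanish, so the
  finite sum below is the full row-by-column product.\<close>

definition ltm_mult :: "inf_matrix \<Rightarrow> inf_matrix \<Rightarrow> inf_matrix" where
  "ltm_mult A B = (\<lambda>n k. \<Sum>i\<le>n. A n i * B i k)"

definition ltm_one :: inf_matrix where
  "ltm_one = (\<lambda>n k. if n = k then 1 else 0)"

text \<open>The two-sided inverse in the monoid of lower triangular matrices. It exists, and is
  then unique, exactly when all diagonal entries are nonzero; for other matrices the value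
  is unspecified.\<close>

definition ltm_inverse :: "inf_matrix \<Rightarrow> inf_matrix" where
  "ltm_inverse A =
     (THE B. lower_triangular B \<and> ltm_mult A B = ltm_one \<and> ltm_mult B A = ltm_one)"

primrec ltm_power :: "inf_matrix \<Rightarrow> nat \<Rightarrow> inf_matrix" where
  "ltm_power A 0 = ltm_one"
| "ltm_power A (Suc n) = ltm_mult A (ltm_power A n)"

definition ltm_power_int :: "inf_matrix \<Rightarrow> int \<Rightarrow> inf_matrix" where
  "ltm_power_int A j =
     (if j \<ge> 0 then ltm_power A (nat j) else ltm_power (ltm_inverse A) (nat (- j)))"

text \<open>In the ranges of \<open>p\<close>, \<open>r\<close> and \<open>i\<close> considered below, with \<open>m \<ge> 3\<close>, none of the
  subtractions on natural numbers truncates.\<close>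

definition SDR :: "nat \<Rightarrow> inf_matrix set" where
  "SDR m = {A. lower_triangular A \<and>
     (\<forall>n k p r. 2 \<le> p \<and> p \<le> m - 1 \<and> r \<le> p - 1 \<longrightarrow>
        (\<Prod>i=0..r. A (n + i) (k + r - i)) *
        (\<Prod>i=0..p - r - 1. A (n + p - i) (k + r + i + 1))
        =
        (\<Prod>i=0..r. A (n + p - i) (k + p - r + i)) *
        (\<Prod>i=0..p - r - 1. A (n + i) (k + p - r - i - 1)))}"

definition SDR_inf :: "inf_matrix set" where
  "SDR_inf = (\<Inter>m\<in>{3..}. SDR m)"

end

theory Submission
  imports Defs "HOL-Computational_Algebra.Formal_Power_Series"
begin

text \<open>
  The matrix is \<open>D T D\<^sup>-\<^sup>1\<close> with \<open>D\<close> the diagonal matrix of \<open>a\<close> and \<open>T\<close> the lower triangular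
  Toeplitz matrix of \<open>f = \<Sum> b\<^sub>n x\<^sup>n\<close>. Toeplitz matrices multiply like their generating power series,
  so the integer powers are \<open>D T\<^sub>j D\<^sup>-\<^sup>1\<close> with \<open>T\<^sub>j\<close> the Toeplitz matrix of \<open>f\<^sup>j\<close>. For such a matrix
  both sides of the SDR identity contain the same rows \<open>n, \<dots>, n + p\<close>, the same columns
  \<open>k, \<dots>, k + p\<close> and the same multiset of differences of row and column index.
\<close>

definition scaled_toeplitz :: "(nat \<Rightarrow> complex) \<Rightarrow> complex fps \<Rightarrow> inf_matrix" where
  "scaled_toeplitz a f = (\<lambda>n k. if k \<le> n then a n * fps_nth f (n - k) * inverse (a k) else 0)"

lemma lower_triangular_scaled_toeplitz: "lower_triangular (scaled_toeplitz a f)"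
  by (auto simp: lower_triangular_def scaled_toeplitz_def)

lemma ltm_mult_assoc:
  assumes "lower_triangular B"
  shows "ltm_mult (ltm_mult A B) C = ltm_mult A (ltm_mult B C)"
proof (intro ext)
  fix n k
  \<comment> \<open>Triangularity of \<open>B\<close> makes the range of \<open>i\<close>
    independent of \<open>l\<close>, so the two sums can be exchanged.\<close>
  have row: "(\<Sum>i\<le>l. B l i * C i k) = (\<Sum>i\<le>n. B l i * C i k)" if "l \<le> n" for l
    using assms that by (intro sum.mono_neutral_left) (auto simp: lower_triangular_def)
  have "ltm_mult (ltm_mult A B) C n k = (\<Sum>i\<le>n. \<Sum>l\<le>n. A n l * B l i * C i k)"
    by (simp add: ltm_mult_def sum_distrib_right)
  also have "\<dots> = (\<Sum>l\<le>n. \<Sum>i\<le>n. A n l * B l i * C i k)"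
    by (rule sum.swap)
  also have "\<dots> = (\<Sum>l\<le>n. A n l * (\<Sum>i\<le>l. B l i * C i k))"
    by (intro sum.cong) (simp_all add: row sum_distrib_left mult.assoc)
  finally show "ltm_mult (ltm_mult A B) C n k = ltm_mult A (ltm_mult B C) n k"
    by (simp add: ltm_mult_def)
qed

lemma ltm_mult_one_left: "ltm_mult ltm_one A = A"
  by (simp add: fun_eq_iff ltm_mult_def ltm_one_def if_distrib[of "\<lambda>x. x * _"] cong: if_cong)

lemma ltm_mult_one_right: "lower_triangular A \<Longrightarrow> ltm_mult A ltm_one = A"
  by (auto simp: fun_eq_iff ltm_mult_def ltm_one_def lower_triangular_def
        if_distrib[of "\<lambda>x. _ * x"] cong: if_cong)

text \<open>Uniqueness of inverses in a monoid resolves the definite description. Triangularity of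
  \<open>A\<close> is what regrouping the product \<open>C A B\<close> requires.\<close>

lemma ltm_inverse_eqI:
  assumes "lower_triangular B" "ltm_mult A B = ltm_one" "ltm_mult B A = ltm_one"
    and "lower_triangular A"
  shows "ltm_inverse A = B"
  unfolding ltm_inverse_def
proof (rule the_equality)
  fix C assume C: "lower_triangular C \<and> ltm_mult A C = ltm_one \<and> ltm_mult C A = ltm_one"
  have "C = ltm_mult C (ltm_mult A B)"
    using C assms(2) by (simp add: ltm_mult_one_right)
  also have "\<dots> = ltm_mult (ltm_mult C A) B"
    using assms(4) by (simp add: ltm_mult_assoc)
  also have "\<dots> = B"
    using C by (simp add: ltm_mult_one_left)
  finally show "C = B" .
qed (use assms in simp)

context
  fixes a :: "nat \<Rightarrow> complex"
  assumes a_nonzero: "a n \<noteq> 0"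
begin

lemma ltm_one_eq_scaled_toeplitz: "ltm_one = scaled_toeplitz a 1"
  by (auto simp: fun_eq_iff ltm_one_def scaled_toeplitz_def a_nonzero)

text \<open>The inner factors \<open>inverse (a i)\<close> and \<open>a i\<close> cancel, which
  leaves a convolution of the coefficients of \<open>f\<close> and \<open>g\<close>.\<close>

lemma ltm_mult_scaled_toeplitz:
  "ltm_mult (scaled_toeplitz a f) (scaled_toeplitz a g) = scaled_toeplitz a (f * g)"
proof (intro ext)
  fix n k
  let ?t = "\<lambda>i. scaled_toeplitz a f n i * scaled_toeplitz a g i k"
  show "ltm_mult (scaled_toeplitz a f) (scaled_toeplitz a g) n k = scaled_toeplitz a (f * g) n k"
  proof (cases "k \<le> n")
    case True
    have "(\<Sum>i\<le>n. ?t i) = (\<Sum>i=k..n. ?t i)"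
      by (intro sum.mono_neutral_right) (auto simp: scaled_toeplitz_def)
    \<comment> \<open>Replacing \<open>i\<close> by \<open>n - i\<close> turns the index of
      \<open>f\<close> into \<open>i\<close> and that of \<open>g\<close> into
      \<open>n - k - i\<close>, as in the Cauchy product.\<close>
    also have "\<dots> = (\<Sum>i=0..n - k. ?t (n - i))"
      using True
      by (intro sum.reindex_bij_witness[of _ "\<lambda>i. n - i" "\<lambda>i. n - i"]) auto
    also have "\<dots> = (\<Sum>i=0..n - k. a n * (fps_nth f i * fps_nth g (n - k - i)) * inverse (a k))"
      using True a_nonzero
      by (intro sum.cong) (auto simp: scaled_toeplitz_def field_simps diff_right_commute)
    finally show ?thesis
      using True
      by (simp add: ltm_mult_def scaled_toeplitz_def fps_mult_nth sum_distrib_left sum_distrib_right)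
  next
    case False
    then show ?thesis
      by (auto simp: ltm_mult_def scaled_toeplitz_def)
  qed
qed

lemma ltm_power_scaled_toeplitz:
  "ltm_power (scaled_toeplitz a f) m = scaled_toeplitz a (f ^ m)"
  by (induction m) (simp_all add: ltm_one_eq_scaled_toeplitz ltm_mult_scaled_toeplitz)

text \<open>A nonzero constant term makes \<open>f\<close> a unit among the power series; in the
  theorem this term is \<open>b 0 = 1\<close>.\<close>

lemma ltm_inverse_scaled_toeplitz:
  assumes "fps_nth f 0 \<noteq> 0"
  shows "ltm_inverse (scaled_toeplitz a f) = scaled_toeplitz a (inverse f)"
  using assms
  by (intro ltm_inverse_eqI)
    (simp_all add: lower_triangular_scaled_toeplitz ltm_mult_scaled_toeplitz
      ltm_one_eq_scaled_toeplitz inverse_mult_eq_1 inverse_mult_eq_1')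

end

lemma prod_atLeast0_rev:
  fixes x :: "nat \<Rightarrow> 'a::comm_monoid_mult"
  shows "(\<Prod>i=0..r. x i) = (\<Prod>i=0..r. x (r - i))"
  by (intro prod.reindex_bij_witness[of _ "\<lambda>i. r - i" "\<lambda>i. r - i"]) auto

lemma prod_atLeast0_split:
  fixes x :: "nat \<Rightarrow> 'a::comm_monoid_mult"
  shows "(\<Prod>i=0..r. x i) * (\<Prod>i=0..q. x (r + 1 + i)) = (\<Prod>i=0..r + q + 1. x i)"
proof -
  have "(\<Prod>i=0..q. x (r + 1 + i)) = (\<Prod>i=r + 1..r + q + 1. x i)"
    by (intro prod.reindex_bij_witness[of _ "\<lambda>i. i - (r + 1)" "\<lambda>i. r + 1 + i"]) auto
  then show ?thesis
    using prod.ub_add_nat[of 0 r x "q + 1"] by (simp add: add.assoc)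
qed

text \<open>With \<open>q = p - r - 1\<close>, the right side is the left side with \<open>r\<close>
  and \<open>q\<close> exchanged and its two products swapped.\<close>

lemma scaled_toeplitz_SDR_identity:
  fixes a :: "nat \<Rightarrow> complex" and f :: "complex fps" and n k r q :: nat
  defines "p \<equiv> r + q + 1"
  defines "A \<equiv> scaled_toeplitz a f"
  shows "(\<Prod>i=0..r. A (n + i) (k + r - i)) * (\<Prod>i=0..q. A (n + p - i) (k + r + i + 1)) =
    (\<Prod>i=0..r. A (n + p - i) (k + p - r + i)) * (\<Prod>i=0..q. A (n + i) (k + p - r - i - 1))"
proof -
  \<comment> \<open>Extending the coefficients by 0 to negative integers covers the entries above
    the diagonal, so \<open>A\<close> factors without case distinction.\<close>
  define c :: "int \<Rightarrow> complex" where "c d = (if d \<ge> 0 then fps_nth f (nat d) else 0)" for d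
  \<comment> \<open>\<open>C s i\<close> is the coefficient at row \<open>n + i\<close> and column
    \<open>k + s - i\<close>. Shifting row and column equally leaves it unchanged, so all four
    products have factors of this form.\<close>
  define C where "C s i = c (int n - int k - int s + 2 * int i)" for s i
  define R where "R i = a (n + i)" for i
  define K where "K i = inverse (a (k + i))" for i
  have A: "A (n + i) (k + l) = R i * c (int n + int i - int k - int l) * K l" for i l
    by (auto simp: A_def scaled_toeplitz_def c_def R_def K_def nat_diff_distrib'
        intro!: arg_cong[of _ _ "fps_nth f"])
  have "(\<Prod>i=0..r. A (n + i) (k + r - i)) = (\<Prod>i=0..r. R i * C r i * K (r - i))"
  proof (intro prod.cong refl)
    fix i assume "i \<in> {0..r}"
    then show "A (n + i) (k + r - i) = R i * C r i * K (r - i)"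
      using A[of i "r - i"] by (simp add: C_def of_nat_diff algebra_simps)
  qed
  moreover have "(\<Prod>i=0..q. A (n + p - i) (k + r + i + 1)) =
      (\<Prod>i=0..q. R (r + 1 + (q - i)) * C q (q - i) * K (r + 1 + i))"
  proof (intro prod.cong refl)
    fix i assume "i \<in> {0..q}"
    then show "A (n + p - i) (k + r + i + 1) = R (r + 1 + (q - i)) * C q (q - i) * K (r + 1 + i)"
      using A[of "r + 1 + (q - i)" "r + 1 + i"]
      by (simp add: p_def C_def of_nat_diff Suc_diff_le algebra_simps)
  qed
  moreover have "(\<Prod>i=0..r. A (n + p - i) (k + p - r + i)) =
      (\<Prod>i=0..r. R (q + 1 + (r - i)) * C r (r - i) * K (q + 1 + i))"
  proof (intro prod.cong refl)
    fix i assume "i \<in> {0..r}"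
    then show "A (n + p - i) (k + p - r + i) = R (q + 1 + (r - i)) * C r (r - i) * K (q + 1 + i)"
      using A[of "q + 1 + (r - i)" "q + 1 + i"]
      by (simp add: p_def C_def of_nat_diff Suc_diff_le algebra_simps)
  qed
  moreover have "(\<Prod>i=0..q. A (n + i) (k + p - r - i - 1)) =
      (\<Prod>i=0..q. R i * C q i * K (q - i))"
  proof (intro prod.cong refl)
    fix i assume "i \<in> {0..q}"
    moreover from this have "k + p - r - i - 1 = k + (q - i)"
      by (simp add: p_def)
    ultimately show "A (n + i) (k + p - r - i - 1) = R i * C q i * K (q - i)"
      using A[of i "q - i"] by (simp add: C_def of_nat_diff algebra_simps)
  qed
  moreover have "(\<Prod>i=0..s. x (t + (s - i))) = (\<Prod>i=0..s. x (t + i))"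
    for s t and x :: "nat \<Rightarrow> complex"
    using prod_atLeast0_rev[of "\<lambda>i. x (t + i)" s] by simp
  moreover have "(\<Prod>i=0..s. x (s - i)) = (\<Prod>i=0..s. x i)" for s and x :: "nat \<Rightarrow> complex"
    by (rule prod_atLeast0_rev[symmetric])
  \<comment> \<open>Both sides are the product of \<open>x\<close> over \<open>0..p\<close>, cut
    after \<open>r + 1\<close> or after \<open>q + 1\<close> indices.\<close>
  moreover have split: "(\<Prod>i=0..r. x i) * (\<Prod>i=0..q. x (r + 1 + i)) =
      (\<Prod>i=0..q. x i) * (\<Prod>i=0..r. x (q + 1 + i))" for x :: "nat \<Rightarrow> complex"
    using prod_atLeast0_split[of x r q] prod_atLeast0_split[of x q r] by (simp add: add.commute)
  \<comment> \<open>\<open>cr\<close> and \<open>cq\<close> stand for the coefficient products,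
    which agree on both sides after reversal; only row and column factors need
    \<open>split\<close>.\<close>
  moreover have "(r1 * cr * k1) * (r2 * cq * k2) = (r4 * cr * k4) * (r3 * cq * k3)"
    if "r1 * r2 = r3 * r4" "k1 * k2 = k3 * k4" for r1 r2 r3 r4 k1 k2 k3 k4 cr cq :: complex
  proof -
    have "(r1 * cr * k1) * (r2 * cq * k2) = (r1 * r2) * (k1 * k2) * cr * cq"
      by (simp only: mult_ac)
    also have "\<dots> = (r4 * cr * k4) * (r3 * cq * k3)"
      unfolding that by (simp only: mult_ac)
    finally show ?thesis .
  qed
  \<comment> \<open>Fixing the row and column products gives an unconditional equation for the final
    rewriting, with \<open>cr\<close> and \<open>cq\<close> left free.\<close>
  note this[OF split[of R] split[of K]]
  ultimately show ?thesis
    by (simp only: prod.distrib)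
qed

lemma scaled_toeplitz_in_SDR_inf: "scaled_toeplitz a f \<in> SDR_inf"
proof -
  have "scaled_toeplitz a f \<in> SDR m" for m
    unfolding SDR_def
  proof (intro CollectI conjI allI impI)
    fix n k p r assume "2 \<le> p \<and> p \<le> m - 1 \<and> r \<le> p - 1"
    then obtain q where p: "p = r + q + 1" and q: "p - r - 1 = q"
      by (intro that[of "p - r - 1"]) auto
    show "(\<Prod>i=0..r. scaled_toeplitz a f (n + i) (k + r - i)) *
        (\<Prod>i=0..p - r - 1. scaled_toeplitz a f (n + p - i) (k + r + i + 1)) =
        (\<Prod>i=0..r. scaled_toeplitz a f (n + p - i) (k + p - r + i)) *
        (\<Prod>i=0..p - r - 1. scaled_toeplitz a f (n + i) (k + p - r - i - 1))"
      \<comment> \<open>The order matters: \<open>p - r - 1\<close> must become \<open>q\<close>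
        before \<open>p\<close> itself is expanded.\<close>
      unfolding q unfolding p by (rule scaled_toeplitz_SDR_identity)
  qed (rule lower_triangular_scaled_toeplitz)
  then show ?thesis
    by (simp add: SDR_inf_def)
qed

theorem theorem2p2:
  fixes a b :: "nat \<Rightarrow> complex" and j :: int
  assumes "b 0 = 1" and "\<And>n. a n \<noteq> 0"
  shows "ltm_power_int (\<lambda>n k. if k \<le> n then a n * b (n - k) * inverse (a k) else 0) j \<in> SDR_inf"
proof -
  have "(\<lambda>n k. if k \<le> n then a n * b (n - k) * inverse (a k) else 0) =
      scaled_toeplitz a (Abs_fps b)"
    by (simp add: scaled_toeplitz_def fun_eq_iff)
  then show ?thesis
    using assms
    by (simp add: ltm_power_int_def ltm_inverse_scaled_toeplitz ltm_power_scaled_toeplitz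
        scaled_toeplitz_in_SDR_inf)
qed

end
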